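(* Let $d\ge 1$ and let $G=(V,E)$ be a connected Eulerian directed graph with a periodic embedding in $\mathbb{R}^d$. Then there is a constant $c>0$ depending only on $G$ such that for every rotor mechanism $m$, every initial rotor configuration $\rho$, every starting vertex $X_0\in V$ and every integer $t\ge 1$, the simple rotor walk $(X_t)_{t\ge0}$ on $G$ satisfies $$\# R_t \ge c\, t^{d/(d+1)}, \qquad\text{where } R_t=\{X_1,\dots,X_t\}.$$
   Context: For a directed graph $G=(V,E)$ (edges are ordered pairs of vertices) and $v\in V$, let $E_v$ be the set of outgoing edges of $v$, assumed finite and nonempty. $G$ is Eulerian if $\mathrm{indeg}(v)=\mathrm{outdeg}(v)$ for all $v\in V$. Connected means that the underlying undirected graph is connected. A rotor configuration is a choice of $\rho(v)\in E_v$ for each $v\in V$. A rotor mechanism is a choice, for each $v$, of a cyclic permutation $m(v)$ of $E_v$ (a permutation consisting of a single cycle through all of $E_v$). Given $\rho$, $m$ and a starting vertex $X_0$, the simple rotor walk is the sequence of vertices $X_0,X_1,\dots$ and rotor configurations $\rho_0=\rho,\rho_1,\dots$ such that for all $t\ge0$: $\rho_{t+1}(X_t)=m(X_t)(\rho_t(X_t))$, $\rho_{t+1}(v)=\rho_t(v)$ for $v\ne X_t$, and $X_{t+1}$ is the target of the edge $\rho_{t+1}(X_t)$. $G$ has a periodic embedding in $\mathbb{R}^d$ if $V$ can be identified with a subset of $\mathbb{R}^d$ such that, for some lattice $\Lambda\subset\mathbb{R}^d$ of full rank $d$, translations by elements of $\Lambda$ map $V$ to $V$ and $E$ to $E$ (so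 they are graph automorphisms), and $V$ consists of finitely many $\Lambda$-orbits. *)

theory Defs
  imports
    "HOL-Analysis.Analysis"
    "HOL-Combinatorics.Orbits"
    "Graph_Theory.Digraph_Component"
begin

text \<open>
  An infinite set of incoming arcs has cardinality 0, so for a vertex whose set of outgoing arcs
  is finite and nonempty the equation below also forces the in-degree to be finite.
\<close>

definition eulerian_digraph :: "'a pair_pre_digraph \<Rightarrow> bool" where
  "eulerian_digraph G \<longleftrightarrow> (\<forall>v\<in>pverts G. in_degree (with_proj G) v = out_degree (with_proj G) v)"

definition full_rank_lattice :: "(real ^ 'd) set \<Rightarrow> bool" where
  "full_rank_lattice L \<longleftrightarrow>
     (\<exists>B. independent B \<and> span B = UNIV \<and> L = {\<Sum>b\<in>B. of_int (z b) *\<^sub>R b | z :: real ^ 'd \<Rightarrow> int. True})"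

text \<open>
  The injection \<open>\<phi>\<close> identifies the vertices with points of Euclidean space. No discreteness of the
  image is demanded separately: it is a finite union of translates of a lattice.
\<close>

definition periodic_embedding :: "'a pair_pre_digraph \<Rightarrow> ('a \<Rightarrow> real ^ 'd) \<Rightarrow> bool" where
  "periodic_embedding G \<phi> \<longleftrightarrow>
     inj_on \<phi> (pverts G) \<and>
     (\<exists>L. full_rank_lattice L \<and>
        (\<forall>l\<in>L. (+) l ` (\<phi> ` pverts G) = \<phi> ` pverts G \<and>
                map_prod ((+) l) ((+) l) ` (map_prod \<phi> \<phi> ` parcs G) = map_prod \<phi> \<phi> ` parcs G) \<and>
        finite {{l + x | l. l \<in> L} | x. x \<in> \<phi> ` pverts G})"

definition rotor_configuration :: "'a pair_pre_digraph \<Rightarrow> ('a \<Rightarrow> 'a \<times> 'a) \<Rightarrow> bool" where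
  "rotor_configuration G \<rho> \<longleftrightarrow> (\<forall>v\<in>pverts G. \<rho> v \<in> out_arcs (with_proj G) v)"

definition rotor_mechanism :: "'a pair_pre_digraph \<Rightarrow> ('a \<Rightarrow> 'a \<times> 'a \<Rightarrow> 'a \<times> 'a) \<Rightarrow> bool" where
  "rotor_mechanism G m \<longleftrightarrow>
     (\<forall>v\<in>pverts G. m v permutes out_arcs (with_proj G) v \<and> cyclic_on (m v) (out_arcs (with_proj G) v))"

text \<open>
  A state of the walk is the pair of the current vertex and the current rotor configuration; the
  rotor is advanced first and the walker then follows the new rotor to its target.
\<close>

definition rotor_step ::
    "('a \<Rightarrow> 'a \<times> 'a \<Rightarrow> 'a \<times> 'a) \<Rightarrow> 'a \<times> ('a \<Rightarrow> 'a \<times> 'a) \<Rightarrow> 'a \<times> ('a \<Rightarrow> 'a \<times> 'a)" where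
  "rotor_step m = (\<lambda>(x, \<rho>). let e = m x (\<rho> x) in (snd e, \<rho>(x := e)))"

primrec rotor_state ::
    "('a \<Rightarrow> 'a \<times> 'a \<Rightarrow> 'a \<times> 'a) \<Rightarrow> ('a \<Rightarrow> 'a \<times> 'a) \<Rightarrow> 'a \<Rightarrow> nat \<Rightarrow> 'a \<times> ('a \<Rightarrow> 'a \<times> 'a)" where
  "rotor_state m \<rho> x 0 = (x, \<rho>)"
| "rotor_state m \<rho> x (Suc t) = rotor_step m (rotor_state m \<rho> x t)"

definition rotor_walk ::
    "('a \<Rightarrow> 'a \<times> 'a \<Rightarrow> 'a \<times> 'a) \<Rightarrow> ('a \<Rightarrow> 'a \<times> 'a) \<Rightarrow> 'a \<Rightarrow> nat \<Rightarrow> 'a" where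
  "rotor_walk m \<rho> x t = fst (rotor_state m \<rho> x t)"

definition rotor_range ::
    "('a \<Rightarrow> 'a \<times> 'a \<Rightarrow> 'a \<times> 'a) \<Rightarrow> ('a \<Rightarrow> 'a \<times> 'a) \<Rightarrow> 'a \<Rightarrow> nat \<Rightarrow> 'a set" where
  "rotor_range m \<rho> x t = rotor_walk m \<rho> x ` {1..t}"

end

theory Submission
  imports Defs
begin

text \<open>
  Cut the walk started at \<open>a\<close> into excursions, each lasting until \<open>a\<close> has been left
  \<open>deg a\<close> times and entered again. As the graph is Eulerian, no arc is crossed twice in an excursion.
  The last exits from the vertices visited so far form a tree directed towards \<open>a\<close>, and following
  it backwards from \<open>a\<close> shows that the next excursion crosses every arc at each of these vertices.
  So after \<open>n\<close> excursions the range contains the ball of radius \<open>n\<close>, which has at least \<open>c n\<^sup>d\<close>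
  points by periodicity, while each excursion takes at most a constant times \<open>#R\<close> steps. Hence
  \<open>t \<le> C n #R\<close> and \<open>#R \<ge> c n\<^sup>d\<close>, and eliminating \<open>n\<close> gives the bound.
\<close>

section \<open>Rotor walks\<close>

text \<open>Orientation is forgotten and loops are added, so that the \<open>n\<close>-th relational
  power is the closed ball of radius \<open>n\<close> in the underlying undirected graph.\<close>

definition neighbour_or_eq :: "'a pair_pre_digraph \<Rightarrow> 'a rel" where
  "neighbour_or_eq G = parcs G \<union> (parcs G)\<inverse> \<union> Id"

text \<open>\<open>S\<close> is the orbit of \<open>s\<close>, its cardinality is the first return
  time of \<open>s\<close>, and iterates before the first return do not repeat.\<close>

lemma cyclic_on_inj_on_funpow:
  assumes "cyclic_on f S" "s \<in> S"
  shows "inj_on (\<lambda>i. (f ^^ i) s) {..<card S}"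
proof -
  have S: "S = orbit f s" and s: "s \<in> orbit f s"
    using assms by (auto simp: cyclic_on_alldef)
  have inj: "inj_on (\<lambda>i. (f ^^ i) s) {0..<funpow_dist1 f s s}"
    by (rule inj_on_funpow_dist1[OF s])
  have "card S = funpow_dist1 f s s"
    unfolding S orbit_conv_funpow_dist1[OF s] by (subst card_image[OF inj]) simp
  with inj show ?thesis by (simp add: lessThan_atLeast0)
qed

section \<open>Visit counts and rotor trees for arbitrary rotor walks\<close>

context
  fixes m :: "'a \<Rightarrow> 'a \<times> 'a \<Rightarrow> 'a \<times> 'a"
begin

definition rotor_at :: "('a \<Rightarrow> 'a \<times> 'a) \<Rightarrow> 'a \<Rightarrow> nat \<Rightarrow> 'a \<Rightarrow> 'a \<times> 'a" where
  "rotor_at \<rho> x t = snd (rotor_state m \<rho> x t)"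

text \<open>Times strictly before \<open>t\<close> are counted, hence departures: a walker standing
  at \<open>v\<close> at time \<open>t\<close> has not yet advanced the rotor there.\<close>

definition visits :: "('a \<Rightarrow> 'a \<times> 'a) \<Rightarrow> 'a \<Rightarrow> nat \<Rightarrow> 'a \<Rightarrow> nat" where
  "visits \<rho> x t v = card {s. s < t \<and> rotor_walk m \<rho> x s = v}"

lemma rotor_0 [simp]: "rotor_walk m \<rho> x 0 = x" "rotor_at \<rho> x 0 = \<rho>"
  by (simp_all add: rotor_walk_def rotor_at_def)

lemma rotor_walk_Suc:
  "rotor_walk m \<rho> x (Suc t) = snd (rotor_at \<rho> x (Suc t) (rotor_walk m \<rho> x t))"
  by (simp add: rotor_walk_def rotor_at_def rotor_step_def Let_def split: prod.split)

lemma rotor_at_Suc: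
  "rotor_at \<rho> x (Suc t) = (rotor_at \<rho> x t)
     (rotor_walk m \<rho> x t := m (rotor_walk m \<rho> x t) (rotor_at \<rho> x t (rotor_walk m \<rho> x t)))"
  by (simp add: rotor_walk_def rotor_at_def rotor_step_def Let_def split: prod.split)

lemma rotor_state_add:
  "rotor_state m \<rho> x (s + t) = rotor_state m (rotor_at \<rho> x s) (rotor_walk m \<rho> x s) t"
  by (induction t) (simp_all add: rotor_walk_def rotor_at_def)

lemma rotor_walk_add:
  "rotor_walk m (rotor_at \<rho> x s) (rotor_walk m \<rho> x s) t = rotor_walk m \<rho> x (s + t)"
  by (simp add: rotor_walk_def rotor_state_add)

lemma visits_0 [simp]: "visits \<rho> x 0 v = 0"
  by (simp add: visits_def)

lemma visits_Suc:
  "visits \<rho> x (Suc t) v = visits \<rho> x t v + (if rotor_walk m \<rho> x t = v then 1 else 0)"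
proof -
  have "{s. s < Suc t \<and> rotor_walk m \<rho> x s = v} =
      {s. s < t \<and> rotor_walk m \<rho> x s = v} \<union> (if rotor_walk m \<rho> x t = v then {t} else {})"
    by (auto simp: less_Suc_eq)
  then show ?thesis by (simp add: visits_def)
qed

lemma visits_mono: "s \<le> t \<Longrightarrow> visits \<rho> x s v \<le> visits \<rho> x t v"
  unfolding visits_def by (intro card_mono) auto

lemma visits_add:
  "visits \<rho> x (s + t) v =
     visits \<rho> x s v + visits (rotor_at \<rho> x s) (rotor_walk m \<rho> x s) t v"
  by (induction t) (simp_all add: visits_Suc rotor_walk_add)

lemma visit_time:
  "k < visits \<rho> x t v \<Longrightarrow> \<exists>s<t. rotor_walk m \<rho> x s = v \<and> visits \<rho> x s v = k"
proof (induction t)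
  case (Suc t)
  show ?case
  proof (cases "k < visits \<rho> x t v")
    case True
    then show ?thesis using Suc.IH less_SucI by blast
  next
    case False
    with Suc.prems have "rotor_walk m \<rho> x t = v" "visits \<rho> x t v = k"
      by (auto simp: visits_Suc split: if_splits)
    then show ?thesis by blast
  qed
qed simp

text \<open>Arrivals use times 1 to \<open>t\<close>, departures times 0 to \<open>t - 1\<close>;
  the counts can differ only through the two endpoints, whose contributions cancel here.\<close>

lemma card_arrivals:
  assumes "rotor_walk m \<rho> x t = v \<longleftrightarrow> x = v"
  shows "card {s. s < t \<and> rotor_walk m \<rho> x (Suc s) = v} = visits \<rho> x t v"
proof -
  let ?W = "rotor_walk m \<rho> x"
  have "card {s. s < t \<and> ?W (Suc s) = v} + (if x = v then 1 else 0)
      = visits \<rho> x t v + (if ?W t = v then 1 else 0)" for t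
  proof (induction t)
    case (Suc t)
    have "{s. s < Suc t \<and> ?W (Suc s) = v}
        = {s. s < t \<and> ?W (Suc s) = v} \<union> (if ?W (Suc t) = v then {t} else {})"
      by (auto simp: less_Suc_eq)
    then have "card {s. s < Suc t \<and> ?W (Suc s) = v}
        = card {s. s < t \<and> ?W (Suc s) = v} + (if ?W (Suc t) = v then 1 else 0)"
      by simp
    with Suc.IH show ?case by (simp only: visits_Suc)
  qed simp
  from this[of t] assms show ?thesis by simp
qed

lemma rotor_at_eq_funpow: "rotor_at \<rho> x t v = (m v ^^ visits \<rho> x t v) (\<rho> v)"
  by (induction t) (auto simp: rotor_at_Suc visits_Suc)

text \<open>The path from \<open>v\<close> along the rotors reaches \<open>x\<close>. The inductive
  form allows induction from the root \<open>x\<close> outwards along the tree.\<close>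

inductive leads :: "('a \<Rightarrow> 'a \<times> 'a) \<Rightarrow> 'a \<Rightarrow> 'a \<Rightarrow> bool" for \<rho> :: "'a \<Rightarrow> 'a \<times> 'a" and x :: 'a where
  leads_refl: "leads \<rho> x x"
| leads_step: "leads \<rho> x (snd (\<rho> v)) \<Longrightarrow> leads \<rho> x v"

text \<open>Redirecting the rotor at the old root \<open>x\<close> along \<open>e\<close> prolongs
  each path into \<open>x\<close> by the arc \<open>e\<close>, so the root moves to the target of
  \<open>e\<close>.\<close>

lemma leads_update: "leads \<rho> x v \<Longrightarrow> leads (\<rho>(x := e)) (snd e) v"
proof (induction rule: leads.induct)
  case leads_refl
  show ?case by (rule leads_step) (simp add: leads.leads_refl)
next
  case (leads_step v)
  show ?case
    by (rule leads.leads_step) (use leads_step.IH in \<open>auto simp: leads.leads_refl\<close>)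
qed

text \<open>The rotors at the visited vertices record the last exits, hence form a tree directed
  towards the current position of the walker.\<close>

lemma visited_leads:
  "s \<le> t \<Longrightarrow> leads (rotor_at \<rho> x t) (rotor_walk m \<rho> x t) (rotor_walk m \<rho> x s)"
proof (induction t)
  case (Suc t)
  show ?case
  proof (cases "s = Suc t")
    case False
    with Suc have "leads (rotor_at \<rho> x t) (rotor_walk m \<rho> x t) (rotor_walk m \<rho> x s)" by simp
    from leads_update[OF this] show ?thesis
      by (simp only: rotor_walk_Suc rotor_at_Suc fun_upd_same)
  qed (simp add: leads_refl)
qed (simp add: leads_refl)

end

section \<open>Arc counting in Eulerian graphs\<close>

locale eulerian_rotor_graph = pair_wf_digraph G
  for G :: "'a pair_pre_digraph" +
  fixes m :: "'a \<Rightarrow> 'a \<times> 'a \<Rightarrow> 'a \<times> 'a"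
  assumes eulerian: "eulerian_digraph G"
    and mechanism: "rotor_mechanism G m"
    and out_arcs_finite: "v \<in> pverts G \<Longrightarrow> finite (out_arcs (with_proj G) v)"
    and out_arcs_nonempty: "v \<in> pverts G \<Longrightarrow> out_arcs (with_proj G) v \<noteq> {}"
begin

abbreviation deg :: "'a \<Rightarrow> nat" where
  "deg v \<equiv> out_degree (with_proj G) v"

abbreviation outs :: "'a \<Rightarrow> ('a \<times> 'a) set" where
  "outs v \<equiv> out_arcs (with_proj G) v"

abbreviation ins :: "'a \<Rightarrow> ('a \<times> 'a) set" where
  "ins v \<equiv> in_arcs (with_proj G) v"

lemma card_outs: "card (outs v) = deg v"
  by (simp add: out_degree_def)

lemma deg_pos: "v \<in> pverts G \<Longrightarrow> 0 < deg v"
  by (simp add: out_degree_def card_gt_0_iff out_arcs_finite out_arcs_nonempty)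

lemma card_ins: "v \<in> pverts G \<Longrightarrow> card (ins v) = deg v"
  using eulerian by (auto simp: eulerian_digraph_def in_degree_def)

lemma ins_finite: "v \<in> pverts G \<Longrightarrow> finite (ins v)"
  using card_ins deg_pos by (intro card_ge_0_finite) simp

lemma cyclic: "v \<in> pverts G \<Longrightarrow> cyclic_on (m v) (outs v)"
  using mechanism by (auto simp: rotor_mechanism_def)

lemma outs_iff: "e \<in> outs v \<longleftrightarrow> e \<in> parcs G \<and> fst e = v"
  by (auto simp: out_arcs_def)

lemma ins_iff: "e \<in> ins v \<longleftrightarrow> e \<in> parcs G \<and> snd e = v"
  by (auto simp: in_arcs_def)

text \<open>The exponents are successors because a rotor is advanced before it is followed;
  injectivity of \<open>m v\<close> cancels the extra step.\<close>

lemma funpow_eq_imp: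
  assumes "v \<in> pverts G" "e \<in> outs v" "i < deg v" "j < deg v" "(m v ^^ Suc i) e = (m v ^^ Suc j) e"
  shows "i = j"
proof -
  have "m v permutes outs v"
    using assms(1) mechanism by (auto simp: rotor_mechanism_def)
  then have "(m v ^^ i) e = (m v ^^ j) e"
    using assms(5) by (auto dest: permutes_inj injD)
  then show ?thesis
    using cyclic_on_inj_on_funpow[OF cyclic assms(2)] assms by (auto simp: card_outs inj_on_def)
qed

text \<open>This makes the initial rotor the last arc to be used in the cyclic order at
  \<open>v\<close>.\<close>

lemma funpow_first_return:
  assumes "v \<in> pverts G" "e \<in> outs v" "(m v ^^ Suc i) e = e"
  shows "deg v \<le> Suc i"
proof (rule ccontr)
  assume "\<not> deg v \<le> Suc i"
  then have "Suc i \<in> {..<card (outs v)}" "0 \<in> {..<card (outs v)}"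
    by (auto simp: card_outs)
  moreover have "(m v ^^ Suc i) e = (m v ^^ 0) e" using assms(3) by simp
  ultimately have "Suc i = 0"
    using inj_onD[OF cyclic_on_inj_on_funpow[OF cyclic[OF assms(1)] assms(2)]] by blast
  then show False by simp
qed

end

locale rotor_walk_run = eulerian_rotor_graph G m
  for G :: "'a pair_pre_digraph" and m +
  fixes \<rho> :: "'a \<Rightarrow> 'a \<times> 'a" and a :: 'a
  assumes config: "rotor_configuration G \<rho>" and start: "a \<in> pverts G"
begin

abbreviation X :: "nat \<Rightarrow> 'a" where "X \<equiv> rotor_walk m \<rho> a"
abbreviation R :: "nat \<Rightarrow> 'a \<Rightarrow> 'a \<times> 'a" where "R \<equiv> rotor_at m \<rho> a"
abbreviation u :: "nat \<Rightarrow> 'a \<Rightarrow> nat" where "u \<equiv> visits m \<rho> a"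

definition crossed :: "nat \<Rightarrow> 'a \<times> 'a" where
  "crossed s = (X s, X (Suc s))"

lemma config_outs: "v \<in> pverts G \<Longrightarrow> \<rho> v \<in> outs v"
  using config by (simp add: rotor_configuration_def)

lemma R_outs: "v \<in> pverts G \<Longrightarrow> R t v \<in> outs v"
  unfolding rotor_at_eq_funpow by (intro cyclic_on_funpow_in cyclic config_outs)

lemma R_config: "rotor_configuration G (R t)"
  using R_outs by (auto simp: rotor_configuration_def)

lemma X_verts: "X t \<in> pverts G"
proof (induction t)
  case (Suc t)
  then have "R (Suc t) (X t) \<in> parcs G"
    using R_outs outs_iff by blast
  then show ?case
    by (simp add: rotor_walk_Suc arc_snd_in_verts)
qed (simp add: start)

text \<open>Crossed arcs are read off from the number of earlier departures from their tail; the
  successor stems from advancing the rotor first.\<close>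

lemma crossed_eq: "crossed s = (m (X s) ^^ Suc (u s (X s))) (\<rho> (X s))"
proof -
  have "fst (R (Suc s) (X s)) = X s"
    using R_outs[OF X_verts] outs_iff by blast
  then have "crossed s = R (Suc s) (X s)"
    by (simp add: crossed_def rotor_walk_Suc prod_eq_iff)
  then show ?thesis
    by (simp add: rotor_at_eq_funpow visits_Suc)
qed

lemma crossed_arc: "crossed s \<in> parcs G"
proof -
  have "(m (X s) ^^ Suc (u s (X s))) (\<rho> (X s)) \<in> outs (X s)"
    by (intro cyclic_on_funpow_in cyclic config_outs X_verts)
  then show ?thesis unfolding crossed_eq outs_iff by blast
qed

text \<open>Two crossings of one arc would be departures from its tail with different indices below
  the degree, and these use different arcs of the cycle.\<close>

lemma inj_on_crossed:
  assumes "\<And>v. v \<in> pverts G \<Longrightarrow> u t v \<le> deg v"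
  shows "inj_on crossed {..<t}"
proof (rule linorder_inj_onI')
  fix i j assume ij: "i \<in> {..<t}" "j \<in> {..<t}" "i < j"
  show "crossed i \<noteq> crossed j"
  proof
    assume eq: "crossed i = crossed j"
    then have X: "X i = X j" by (simp add: crossed_def)
    have "u (Suc i) (X j) \<le> u j (X j)" "u (Suc j) (X j) \<le> u t (X j)"
      using ij by (auto intro: visits_mono)
    then have "u i (X j) < u j (X j)" "u j (X j) < deg (X j)"
      using assms[OF X_verts, of j] by (auto simp: visits_Suc X)
    moreover have "u i (X j) = u j (X j)"
      using eq calculation unfolding crossed_eq X
      by (intro funpow_eq_imp[OF X_verts config_outs[OF X_verts]]) auto
    ultimately show False by simp
  qed
qed

text \<open>If some vertex other than \<open>a\<close> were exceeded first, then one of its incoming arcs would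
  have been crossed twice before.\<close>

lemma visits_le_deg:
  assumes "u T a \<le> deg a" "t \<le> T" "v \<in> pverts G"
  shows "u t v \<le> deg v"
  using assms(2,3)
proof (induction t arbitrary: v)
  case (Suc t)
  show ?case
  proof (cases "X t = v \<and> v \<noteq> a")
    case False
    have "u (Suc t) a \<le> u T a" by (intro visits_mono Suc.prems)
    with False Suc assms(1) show ?thesis
      by (cases "v = a") (auto simp: visits_Suc)
  next
    case True
    let ?A = "{s. s < t \<and> X (Suc s) = v}"
    \<comment> \<open>As \<open>v\<close> is not the starting vertex, each visit is preceded by an
      arrival. Up to time \<open>t\<close> these arrivals use distinct incoming arcs, of which there
      are only \<open>deg v\<close>.\<close>
    have "{s. s < Suc t \<and> X s = v} = Suc ` ?A"
    proof (intro set_eqI iffI)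
      fix s assume "s \<in> {s. s < Suc t \<and> X s = v}"
      then show "s \<in> Suc ` ?A" using True by (cases s) auto
    qed auto
    then have "u (Suc t) v = card ?A"
      by (simp add: visits_def card_image)
    also have "\<dots> \<le> card (ins v)"
    proof (rule card_inj_on_le[where f = crossed])
      show "inj_on crossed ?A"
        by (rule inj_on_subset[OF inj_on_crossed[of t]]) (use Suc in auto)
      show "crossed ` ?A \<subseteq> ins v"
        using crossed_arc by (auto simp: ins_iff) (simp add: crossed_def)
    qed (simp add: ins_finite Suc.prems)
    finally show ?thesis using card_ins Suc.prems by simp
  qed
qed simp

section \<open>One complete excursion from \<open>a\<close>\<close>

context
  fixes T :: nat
  assumes return: "X T = a" and full: "u T a = deg a"
begin

lemma inj_on_crossed_excursion: "inj_on crossed {..<T}"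
  using visits_le_deg[of T T] full by (intro inj_on_crossed) simp

text \<open>The \<open>deg v\<close> departures use distinct arcs and thus exhaust the arcs leaving
  \<open>v\<close>.\<close>

lemma saturated_out_crossed:
  assumes "v \<in> pverts G" "u T v = deg v" "e \<in> outs v"
  shows "\<exists>s<T. crossed s = e"
proof -
  let ?A = "{s. s < T \<and> X s = v}"
  have "crossed ` ?A = outs v"
  proof (rule card_subset_eq)
    show "crossed ` ?A \<subseteq> outs v"
      using crossed_arc by (auto simp: outs_iff) (simp add: crossed_def)
    have "inj_on crossed ?A"
      by (rule inj_on_subset[OF inj_on_crossed_excursion]) auto
    then show "card (crossed ` ?A) = card (outs v)"
      using assms(2) by (simp add: card_image card_outs visits_def)
  qed (simp add: out_arcs_finite assms)
  then have "e \<in> crossed ` ?A" using assms(3) by simp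
  then show ?thesis by (elim imageE) blast
qed

text \<open>The excursion is a closed walk, so \<open>v\<close> is entered as often as it is left;
  these \<open>deg v\<close> arrivals use distinct arcs, and the in-degree is also
  \<open>deg v\<close>.\<close>

lemma saturated_in_crossed:
  assumes "v \<in> pverts G" "u T v = deg v" "e \<in> ins v"
  shows "\<exists>s<T. crossed s = e"
proof -
  let ?A = "{s. s < T \<and> X (Suc s) = v}"
  have "crossed ` ?A = ins v"
  proof (rule card_subset_eq)
    show "crossed ` ?A \<subseteq> ins v"
      using crossed_arc by (auto simp: ins_iff) (simp add: crossed_def)
    have "inj_on crossed ?A"
      by (rule inj_on_subset[OF inj_on_crossed_excursion]) auto
    then show "card (crossed ` ?A) = card (ins v)"
      using assms(1,2) card_arrivals[of m \<rho> a T v] return by (simp add: card_image card_ins)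
  qed (simp add: ins_finite assms)
  then have "e \<in> crossed ` ?A" using assms(3) by simp
  then show ?thesis by (elim imageE) blast
qed

text \<open>The arc \<open>\<rho> v\<close> is the last one in the cyclic order at \<open>v\<close>; it has been crossed because it
  enters a saturated vertex, so all the other arcs leaving \<open>v\<close> have been crossed, too.\<close>

lemma leads_saturated:
  assumes "leads \<rho> a v" "v \<in> pverts G"
  shows "u T v = deg v"
  using assms
proof (induction rule: leads.induct)
  case leads_refl
  show ?case by (rule full)
next
  case (leads_step v)
  have out: "\<rho> v \<in> outs v" using leads_step.prems by (rule config_outs)
  then have arc: "\<rho> v \<in> parcs G" "fst (\<rho> v) = v" by (simp_all add: outs_iff)
  then have w: "snd (\<rho> v) \<in> pverts G" by (simp add: arc_snd_in_verts)
  obtain s where s: "s < T" "crossed s = \<rho> v"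
    using saturated_in_crossed[OF w leads_step.IH[OF w]] arc ins_iff by blast
  then have "X s = v" using arc(2) by (metis crossed_def fst_conv)
  \<comment> \<open>Crossing the initial rotor \<open>\<rho> v\<close> at time \<open>s\<close>
    means that the cycle at \<open>v\<close> has returned to it after \<open>Suc (u s v)\<close>
    steps.\<close>
  with s out leads_step.prems have "deg v \<le> Suc (u s v)"
    by (intro funpow_first_return) (auto simp: crossed_eq)
  also have "\<dots> \<le> u T v"
    using visits_mono[of "Suc s" T m \<rho> a v] s(1) \<open>X s = v\<close> by (simp add: visits_Suc)
  finally show ?case
    using visits_le_deg[of T T v] full leads_step.prems by simp
qed

lemma excursion_visits_neighbours:
  assumes "leads \<rho> a v" "v \<in> pverts G" "(v, w) \<in> parcs G \<or> (w, v) \<in> parcs G"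
  shows "w \<in> X ` {..T}"
proof -
  obtain s where "s < T" "crossed s = (v, w) \<or> crossed s = (w, v)"
    using assms(3) saturated_in_crossed[OF assms(2) leads_saturated[OF assms(1,2)], of "(w, v)"]
      saturated_out_crossed[OF assms(2) leads_saturated[OF assms(1,2)], of "(v, w)"]
    by (auto simp: ins_iff outs_iff)
  then have "w = X s \<or> w = X (Suc s)" "s \<le> T" "Suc s \<le> T" by (auto simp: crossed_def)
  then show ?thesis by blast
qed

end

section \<open>Concatenating excursions\<close>

lemma shift: "rotor_walk_run G m (R s) (X s)"
  by unfold_locales (auto simp: R_config X_verts)

text \<open>Each step is a departure from a visited vertex, and no vertex is left more often than
  its degree.\<close>

lemma excursion_time_le:
  assumes "u T a \<le> deg a" and D: "\<And>v. v \<in> pverts G \<Longrightarrow> deg v \<le> D"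
  shows "T \<le> D * card (X ` {..T})"
proof -
  have "T = card (\<Union>v\<in>X ` {..T}. {s. s < T \<and> X s = v})"
  proof -
    have "(\<Union>v\<in>X ` {..T}. {s. s < T \<and> X s = v}) = {..<T}"
      using less_imp_le by blast
    then show ?thesis by simp
  qed
  also have "\<dots> \<le> (\<Sum>v\<in>X ` {..T}. u T v)"
    unfolding visits_def by (rule card_UN_le) simp
  also have "\<dots> \<le> (\<Sum>v\<in>X ` {..T}. D)"
  proof (rule sum_mono)
    fix v assume "v \<in> X ` {..T}"
    then have "v \<in> pverts G" using X_verts by auto
    then show "u T v \<le> D"
      using visits_le_deg[OF assms(1) order_refl] D order_trans by blast
  qed
  finally show ?thesis by (simp add: mult.commute)
qed

lemma visited_excursion_time_le:
  assumes "X s = a" "s \<le> t" "u t a \<le> u s a + deg a" "\<And>v. v \<in> pverts G \<Longrightarrow> deg v \<le> D"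
  shows "t \<le> s + D * card (X ` {..t})"
proof -
  \<comment> \<open>The walk restarted at time \<open>s\<close> is again a run from
    \<open>a\<close>; visit counts are additive, so it leaves \<open>a\<close> at most
    \<open>deg a\<close> times until time \<open>t\<close>.\<close>
  interpret S: rotor_walk_run G m "R s" "X s" by (rule shift)
  have "t - s \<le> D * card (S.X ` {..t - s})"
    using assms visits_add[of m \<rho> a s "t - s" a] by (intro S.excursion_time_le) auto
  also have "S.X ` {..t - s} \<subseteq> X ` {..t}"
    using assms(2) by (auto simp: rotor_walk_add)
  then have "D * card (S.X ` {..t - s}) \<le> D * card (X ` {..t})"
    by (intro mult_left_mono card_mono) auto
  finally show ?thesis by simp
qed

lemma excursions:
  assumes D: "\<And>v. v \<in> pverts G \<Longrightarrow> deg v \<le> D"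
  shows "X T = a \<Longrightarrow> u T a = n * deg a \<Longrightarrow>
    (neighbour_or_eq G ^^ n) `` {a} \<subseteq> X ` {..T} \<and> T \<le> n * (D * card (X ` {..T}))"
proof (induction n arbitrary: T)
  case 0
  have "T = 0"
  proof (rule ccontr)
    assume "T \<noteq> 0"
    then have "u (Suc 0) a \<le> u T a" by (intro visits_mono) simp
    with 0 show False by (simp add: visits_Suc)
  qed
  then show ?case by simp
next
  case (Suc n)
  \<comment> \<open>Departures are indexed from 0, so the one with index \<open>n * deg a\<close>
    starts the last excursion, after \<open>n\<close> complete ones.\<close>
  obtain s where s: "s < T" "X s = a" "u s a = n * deg a"
    using visit_time[of "n * deg a" m \<rho> a T a] Suc.prems deg_pos[OF start] by auto
  note IH = Suc.IH[OF s(2,3)]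
  interpret S: rotor_walk_run G m "R s" "X s" by (rule shift)
  have T: "S.X (T - s) = X s" "S.u (T - s) (X s) = deg (X s)"
    using s Suc.prems visits_add[of m \<rho> a s "T - s" a] rotor_walk_add[of m \<rho> a s "T - s"]
    by simp_all
  have sub: "S.X ` {..T - s} \<subseteq> X ` {..T}" "X ` {..s} \<subseteq> X ` {..T}"
    using s(1) by (auto simp: rotor_walk_add)
  have "w \<in> X ` {..T}" if w: "(a, w) \<in> neighbour_or_eq G ^^ Suc n" for w
  proof -
    obtain v where v: "(a, v) \<in> neighbour_or_eq G ^^ n" "(v, w) \<in> neighbour_or_eq G"
      using w by auto
    then obtain r where r: "v = X r" "r \<le> s" using IH by auto
    \<comment> \<open>Vertices seen before time \<open>s\<close> lie in the rotor tree at time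
      \<open>s\<close>, which is why the last excursion adds all their neighbours.\<close>
    then have "leads (R s) (X s) v" by (simp add: visited_leads)
    show ?thesis
    proof (cases "v = w")
      case True
      then show ?thesis using sub(2) r by blast
    next
      case False
      then have "(v, w) \<in> parcs G \<or> (w, v) \<in> parcs G"
        using v(2) by (auto simp: neighbour_or_eq_def)
      then have "w \<in> S.X ` {..T - s}"
        using \<open>leads (R s) (X s) v\<close> X_verts r(1) by (intro S.excursion_visits_neighbours[OF T]) simp_all
      then show ?thesis using sub(1) by blast
    qed
  qed
  then have sub_ball: "(neighbour_or_eq G ^^ Suc n) `` {a} \<subseteq> X ` {..T}" by blast
  have "T \<le> s + D * card (X ` {..T})"
    using s Suc.prems D by (intro visited_excursion_time_le) auto
  moreover have "n * (D * card (X ` {..s})) \<le> n * (D * card (X ` {..T}))"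
    using sub(2) by (intro mult_left_mono card_mono) auto
  ultimately have "T \<le> Suc n * (D * card (X ` {..T}))"
    using IH unfolding mult_Suc by linarith
  with sub_ball show ?case by blast
qed

text \<open>Time \<open>t\<close> falls after \<open>n\<close> complete excursions, which cover the
  ball, and into a further one, which accounts for the successor in the time bound.\<close>

lemma ball_subset_range:
  assumes D: "\<And>v. v \<in> pverts G \<Longrightarrow> deg v \<le> D"
  shows "\<exists>n. (neighbour_or_eq G ^^ n) `` {a} \<subseteq> X ` {..t} \<and> t \<le> Suc n * (D * card (X ` {..t}))"
proof (cases "t = 0")
  case True
  then show ?thesis by (intro exI[of _ 0]) simp
next
  case False
  \<comment> \<open>Subtracting 1 guarantees \<open>n * deg a < u t a\<close>, so the departure that
    starts the current excursion has already happened.\<close>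
  define n where "n = (u t a - 1) div deg a"
  have "u (Suc 0) a \<le> u t a" using False by (intro visits_mono) simp
  then have pos: "0 < u t a" by (simp add: visits_Suc)
  have "n * deg a \<le> u t a - 1" by (simp add: n_def)
  then have "n * deg a < u t a" using pos by simp
  then obtain s where s: "s < t" "X s = a" "u s a = n * deg a"
    using visit_time[of "n * deg a" m \<rho> a t a] by blast
  have "u t a - 1 < n * deg a + deg a"
    using dividend_less_div_times[OF deg_pos[OF start], of "u t a - 1"]
    by (simp add: n_def add.commute)
  then have "t \<le> s + D * card (X ` {..t})"
    using s D by (intro visited_excursion_time_le) auto
  moreover note IH = excursions[OF D s(2,3)]
  have sub: "X ` {..s} \<subseteq> X ` {..t}" using s by auto
  moreover have "n * (D * card (X ` {..s})) \<le> n * (D * card (X ` {..t}))"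
    using sub by (intro mult_left_mono card_mono) auto
  ultimately have "t \<le> Suc n * (D * card (X ` {..t}))"
    using IH unfolding mult_Suc by linarith
  then show ?thesis using IH sub by blast
qed

end

section \<open>Growth of balls\<close>

lemma relpow_mono_exponent:
  assumes "Id \<subseteq> r" "m \<le> n"
  shows "r ^^ m \<subseteq> r ^^ n"
  using assms(2)
proof (induction n rule: dec_induct)
  case (step n)
  have "r ^^ n \<subseteq> r ^^ Suc n" using assms(1) by auto
  with step.IH show ?case by blast
qed simp

text \<open>On \<open>A\<close> the map \<open>f\<close> factors through \<open>g\<close>.\<close>

lemma finite_image_if_constant_on_fibres:
  assumes "finite (g ` A)" "\<And>x y. x \<in> A \<Longrightarrow> y \<in> A \<Longrightarrow> g x = g y \<Longrightarrow> f x = f y"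
  shows "finite (f ` A)"
proof -
  define h where "h z = f (SOME x. x \<in> A \<and> g x = z)" for z
  have "f x = h (g x)" if "x \<in> A" for x
    unfolding h_def using that assms(2)[OF _ that] someI[of "\<lambda>y. y \<in> A \<and> g y = g x" x]
    by (metis (mono_tags, lifting))
  then have "f ` A \<subseteq> h ` g ` A" by auto
  then show ?thesis using assms(1) finite_surj by blast
qed

lemma connected_imp_neighbour_relpow:
  assumes "Digraph_Component.connected (with_proj G)" "v \<in> pverts G" "w \<in> pverts G"
  shows "\<exists>n. (v, w) \<in> neighbour_or_eq G ^^ n"
proof -
  have "(v, w) \<in> rtrancl_on (pverts G) (\<Union>e\<in>parcs G. {(fst e, snd e), (snd e, fst e)})"
    using assms by (simp add: Digraph_Component.connected_def strongly_connected_def mk_symmetric_def reachable_def)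
  then have "(v, w) \<in> (neighbour_or_eq G)\<^sup>*"
    by (induction rule: rtrancl_on_induct)
       (auto simp: neighbour_or_eq_def elim!: rtrancl_into_rtrancl)
  then show ?thesis by (simp add: rtrancl_power)
qed

text \<open>Reduces the lattice to what the growth argument uses: an additive group containing as
  many independent vectors as the dimension.\<close>

lemma full_rank_lattice_basis:
  assumes "full_rank_lattice (L :: (real ^ 'd) set)"
  obtains B :: "(real ^ 'd) set" where "finite B" "card B = CARD('d)" "independent B" "B \<subseteq> L"
    "\<forall>x\<in>L. \<forall>y\<in>L. x + y \<in> L" "\<forall>x\<in>L. - x \<in> L" "0 \<in> L"
proof -
  obtain B where B: "independent B" "span B = UNIV"
    "L = {\<Sum>b\<in>B. of_int (z b) *\<^sub>R b | z :: real ^ 'd \<Rightarrow> int. True}"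
    using assms unfolding full_rank_lattice_def by blast
  have fin: "finite B" using B(1) independent_bound by blast
  have L_I: "(\<Sum>b\<in>B. of_int (z b) *\<^sub>R b) \<in> L" for z :: "real ^ 'd \<Rightarrow> int"
    unfolding B(3) by (intro CollectI exI[of _ z] conjI TrueI refl)
  have "card B = dim (span B)" using B(1) by (simp add: dim_eq_card_independent)
  then have card: "card B = CARD('d)" by (simp add: B(2))
  have sub: "B \<subseteq> L"
  proof
    fix b assume b: "b \<in> B"
    have "(\<Sum>b'\<in>B. of_int (if b' = b then 1 else 0) *\<^sub>R b') = (\<Sum>b'\<in>B. if b' = b then b' else 0)"
      by (intro sum.cong) auto
    also have "\<dots> = b" using b fin by simp
    finally have "b = (\<Sum>b'\<in>B. of_int (if b' = b then 1 else 0) *\<^sub>R b')" by (rule sym)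
    then show "b \<in> L" using L_I[of "\<lambda>b'. if b' = b then 1 else 0"] by simp
  qed
  have add: "x + y \<in> L" if xy: "x \<in> L" "y \<in> L" for x y
  proof -
    obtain z z' :: "real ^ 'd \<Rightarrow> int"
      where "x = (\<Sum>b\<in>B. of_int (z b) *\<^sub>R b)" "y = (\<Sum>b\<in>B. of_int (z' b) *\<^sub>R b)"
      using xy unfolding B(3) by blast
    then have "x + y = (\<Sum>b\<in>B. of_int (z b + z' b) *\<^sub>R b)"
      by (simp add: scaleR_add_left sum.distrib)
    then show ?thesis using L_I[of "\<lambda>b. z b + z' b"] by simp
  qed
  have minus: "- x \<in> L" if x: "x \<in> L" for x
  proof -
    obtain z :: "real ^ 'd \<Rightarrow> int" where "x = (\<Sum>b\<in>B. of_int (z b) *\<^sub>R b)"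
      using x unfolding B(3) by blast
    then have "- x = (\<Sum>b\<in>B. of_int (- z b) *\<^sub>R b)"
      by (simp add: sum_negf)
    then show ?thesis using L_I[of "\<lambda>b. - z b"] by simp
  qed
  have zero: "0 \<in> L" using L_I[of "\<lambda>_. 0"] by simp
  show ?thesis
    by (rule that[OF fin card B(1) sub _ _ zero]) (use add minus in blast)+
qed

text \<open>Provides \<open>(q + 1) ^ card B\<close> distinct lattice points; the extensional
  function space makes each coefficient vector a single function.\<close>

lemma inj_on_nat_combination:
  fixes B :: "'v :: real_vector set"
  assumes "finite B" "independent B"
  shows "inj_on (\<lambda>z. \<Sum>b\<in>B. real (z b) *\<^sub>R b) (B \<rightarrow>\<^sub>E {..q})"
proof (rule inj_onI)
  fix z z' assume z: "z \<in> B \<rightarrow>\<^sub>E {..q}" "z' \<in> B \<rightarrow>\<^sub>E {..q}"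
    and eq: "(\<Sum>b\<in>B. real (z b) *\<^sub>R b) = (\<Sum>b\<in>B. real (z' b) *\<^sub>R b)"
  have "(\<Sum>b\<in>B. (real (z b) - real (z' b)) *\<^sub>R b) = 0"
    using eq by (simp add: scaleR_diff_left sum_subtractf)
  then have "real (z b) - real (z' b) = 0" if "b \<in> B" for b
    using independentD[OF assms(2,1) subset_refl, of "\<lambda>b. real (z b) - real (z' b)" b] that by blast
  then show "z = z'" using z by (intro PiE_ext) auto
qed

section \<open>Translation-invariant relations with finitely many orbits\<close>

locale lattice_invariant =
  fixes S :: "'v :: real_vector rel" and L P :: "'v set"
  assumes L_add: "x \<in> L \<Longrightarrow> y \<in> L \<Longrightarrow> x + y \<in> L"
    and L_minus: "x \<in> L \<Longrightarrow> - x \<in> L"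
    and L_0: "0 \<in> L"
    and P_translate: "l \<in> L \<Longrightarrow> p \<in> P \<Longrightarrow> l + p \<in> P"
    and S_translate: "l \<in> L \<Longrightarrow> (p, q) \<in> S \<Longrightarrow> (l + p, l + q) \<in> S"
    and finite_orbits: "finite {{l + x | l. l \<in> L} | x. x \<in> P}"
begin

lemma relpow_translate: "l \<in> L \<Longrightarrow> (p, q) \<in> S ^^ n \<Longrightarrow> (l + p, l + q) \<in> S ^^ n"
  by (induction n arbitrary: q) (auto dest: S_translate)

lemma relpow_translate_iff:
  "l \<in> L \<Longrightarrow> (l + p, l + q) \<in> S ^^ n \<longleftrightarrow> (p, q) \<in> S ^^ n"
  using relpow_translate[of l p q n] relpow_translate[OF L_minus, of l "l + p" "l + q" n] by auto

text \<open>An invariant function is constant on each orbit and so takes finitely many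
  values.\<close>

lemma bounded_if_invariant:
  fixes f :: "'v \<Rightarrow> nat"
  assumes "\<And>l p. l \<in> L \<Longrightarrow> p \<in> P \<Longrightarrow> f (l + p) = f p"
  shows "\<exists>K. \<forall>p\<in>P. f p \<le> K"
proof -
  have "finite (f ` P)"
  proof (rule finite_image_if_constant_on_fibres[where g = "\<lambda>x. {l + x | l. l \<in> L}"])
    have "(\<lambda>x. {l + x |l. l \<in> L}) ` P = {{l + x | l. l \<in> L} | x. x \<in> P}" by blast
    then show "finite ((\<lambda>x. {l + x |l. l \<in> L}) ` P)" using finite_orbits by simp
    fix x y assume "x \<in> P" "y \<in> P" "{l + x | l. l \<in> L} = {l + y | l. l \<in> L}"
    moreover have "x \<in> {l + x | l. l \<in> L}" using L_0 by force
    ultimately obtain l where "l \<in> L" "x = l + y" by blast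
    then show "f x = f y" using assms \<open>y \<in> P\<close> by simp
  qed
  then show ?thesis by (meson Max_ge finite_imageI imageI)
qed

text \<open>The distance from \<open>p\<close> to \<open>b + p\<close> is invariant under the
  lattice, since translations commute; hence it is bounded over all \<open>p\<close>.\<close>

lemma uniform_translation_steps:
  assumes refl: "Id \<subseteq> S" and conn: "\<And>p q. p \<in> P \<Longrightarrow> q \<in> P \<Longrightarrow> \<exists>n. (p, q) \<in> S ^^ n"
    and B: "finite B" "B \<subseteq> L"
  shows "\<exists>K>0. \<forall>b\<in>B. \<forall>p\<in>P. (p, b + p) \<in> S ^^ K"
proof -
  define f where "f b p = (LEAST n. (p, b + p) \<in> S ^^ n)" for b p
  have "\<exists>K. \<forall>p\<in>P. f b p \<le> K" if b: "b \<in> B" for b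
  proof (rule bounded_if_invariant)
    fix l p assume "l \<in> L" "p \<in> P"
    then show "f b (l + p) = f b p"
      unfolding f_def using relpow_translate_iff[of l p "b + p"] by (simp add: add.left_commute)
  qed
  then obtain k where k: "\<forall>b\<in>B. \<forall>p\<in>P. f b p \<le> k b"
    using bchoice[of B "\<lambda>b K. \<forall>p\<in>P. f b p \<le> K"] by blast
  \<comment> \<open>The sum dominates every \<open>k b\<close>, and the successor makes
    \<open>K\<close> positive. Reflexivity pads shorter paths to length exactly
    \<open>K\<close>.\<close>
  define K where "K = Suc (\<Sum>b\<in>B. k b)"
  have "(p, b + p) \<in> S ^^ K" if "b \<in> B" "p \<in> P" for b p
  proof -
    have "b + p \<in> P" by (rule P_translate[OF subsetD[OF B(2) that(1)] that(2)])
    then have "\<exists>n. (p, b + p) \<in> S ^^ n" by (rule conn[OF that(2)])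
    then have "(p, b + p) \<in> S ^^ f b p" unfolding f_def by (rule LeastI_ex)
    moreover have "f b p \<le> K"
    proof -
      have "f b p \<le> k b" using k that by blast
      also have "\<dots> \<le> (\<Sum>b\<in>B. k b)" using that(1) B(1) by (intro member_le_sum) auto
      finally show ?thesis by (simp add: K_def)
    qed
    ultimately show ?thesis using relpow_mono_exponent[OF refl] by blast
  qed
  moreover have "K > 0" by (simp add: K_def)
  ultimately show ?thesis by (intro exI[of _ K] conjI ballI) simp_all
qed

text \<open>The basis vectors are added one at a time, at \<open>K\<close> steps each; membership in
  \<open>P\<close> is carried along because the next translation step requires it.\<close>

lemma translation_path:
  assumes K: "\<And>b p. b \<in> B \<Longrightarrow> p \<in> P \<Longrightarrow> (p, b + p) \<in> S ^^ K"
    and B: "finite B" "B \<subseteq> L" and p: "p \<in> P"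
  shows "(p, (\<Sum>b\<in>B. real (z b) *\<^sub>R b) + p) \<in> S ^^ (K * (\<Sum>b\<in>B. z b)) \<and>
    (\<Sum>b\<in>B. real (z b) *\<^sub>R b) + p \<in> P"
  using B K
proof (induction B rule: finite_induct)
  case empty
  then show ?case using p by simp
next
  case (insert b B)
  let ?s = "(\<Sum>b\<in>B. real (z b) *\<^sub>R b) + p"
  have "(?s, real n *\<^sub>R b + ?s) \<in> S ^^ (K * n) \<and> real n *\<^sub>R b + ?s \<in> P" for n
  proof (induction n)
    case 0
    then show ?case using insert by simp
  next
    case (Suc n)
    then have "(real n *\<^sub>R b + ?s, b + (real n *\<^sub>R b + ?s)) \<in> S ^^ K" "b + (real n *\<^sub>R b + ?s) \<in> P"
      using insert.prems P_translate by auto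
    moreover have "b + (real n *\<^sub>R b + ?s) = real (Suc n) *\<^sub>R b + ?s"
      by (simp add: scaleR_add_left)
    moreover have "S ^^ (K * Suc n) = S ^^ (K * n) O S ^^ K"
      by (simp add: relpow_add[symmetric] add.commute)
    ultimately show ?case using Suc by auto
  qed
  moreover have "S ^^ (K * (\<Sum>b\<in>insert b B. z b)) = S ^^ (K * (\<Sum>b\<in>B. z b)) O S ^^ (K * z b)"
    using insert.hyps by (simp add: relpow_add[symmetric] algebra_simps)
  ultimately show ?case
    using insert by (auto simp: add.assoc)
qed

text \<open>With \<open>q = n div (K * card B)\<close>, all combinations with coefficients up to
  \<open>q\<close> are reached within \<open>n\<close> steps. Bounding every finite superset
  \<open>F\<close> avoids speaking of the cardinality of a possibly infinite ball.\<close>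

lemma ball_growth:
  assumes refl: "Id \<subseteq> S" and conn: "\<And>p q. p \<in> P \<Longrightarrow> q \<in> P \<Longrightarrow> \<exists>n. (p, q) \<in> S ^^ n"
    and B: "finite B" "B \<subseteq> L" "independent B" "B \<noteq> {}"
  shows "\<exists>c>0. \<forall>p\<in>P. \<forall>n F. finite F \<longrightarrow> (S ^^ n) `` {p} \<subseteq> F \<longrightarrow>
    c * real (Suc n) ^ card B \<le> real (card F)"
proof -
  obtain K where K: "K > 0" "\<And>b p. b \<in> B \<Longrightarrow> p \<in> P \<Longrightarrow> (p, b + p) \<in> S ^^ K"
    using uniform_translation_steps[OF refl conn B(1,2)] by blast
  define M where "M = K * card B"
  have M: "M > 0" using K B by (simp add: M_def card_gt_0_iff)
  have "(1 / real M) ^ card B * real (Suc n) ^ card B \<le> real (card F)"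
    if p: "p \<in> P" and F: "finite F" "(S ^^ n) `` {p} \<subseteq> F" for p n F
  proof -
    define q where "q = n div M"
    let ?g = "\<lambda>z. (\<Sum>b\<in>B. real (z b) *\<^sub>R b) + p"
    have "?g z \<in> F" if z: "z \<in> B \<rightarrow>\<^sub>E {..q}" for z
    proof -
      have "(\<Sum>b\<in>B. z b) \<le> (\<Sum>b\<in>B. q)" using z by (intro sum_mono) auto
      then have "K * (\<Sum>b\<in>B. z b) \<le> M * q" by (simp add: M_def)
      also have "\<dots> \<le> n" by (simp add: q_def)
      finally show ?thesis
        using relpow_mono_exponent[OF refl] translation_path[OF K(2) B(1,2) p, of z] F(2) by blast
    qed
    moreover have "inj_on ?g (B \<rightarrow>\<^sub>E {..q})"
      using inj_on_nat_combination[OF B(1,3), of q] by (simp add: inj_on_def)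
    ultimately have "card (B \<rightarrow>\<^sub>E {..q}) \<le> card F"
      using F(1) by (intro card_inj_on_le[where f = ?g]) auto
    then have "(q + 1) ^ card B \<le> card F" using B(1) by (simp add: card_PiE)
    then have "real (q + 1) ^ card B \<le> real (card F)"
      by (metis of_nat_le_iff of_nat_power)
    \<comment> \<open>Rounding down in \<open>q\<close> is absorbed here, which yields the constant
      \<open>(1 / real M) ^ card B\<close>.\<close>
    moreover have "Suc n \<le> M * (q + 1)"
      using M dividend_less_times_div[of M n] by (simp add: q_def Suc_le_eq)
    then have "real (Suc n) / real M \<le> real (q + 1)"
      using M by (metis divide_le_eq mult.commute of_nat_0_less_iff of_nat_le_iff of_nat_mult)
    then have "(real (Suc n) / real M) ^ card B \<le> real (q + 1) ^ card B"
      by (intro power_mono) auto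
    ultimately show ?thesis
      by (simp add: power_mult_distrib[symmetric])
  qed
  then show ?thesis using M by (intro exI[of _ "(1 / real M) ^ card B"]) auto
qed

end

text \<open>The arcs are moved along \<open>\<phi>\<close> to the points of the embedding, where the
  lattice acts; balls correspond under \<open>\<phi>\<close>, and the degree is an invariant
  function.\<close>

lemma periodic_growth_and_degree:
  fixes \<phi> :: "'a \<Rightarrow> real ^ 'd"
  assumes G: "pair_wf_digraph G"
    and conn: "Digraph_Component.connected (with_proj G)"
    and emb: "periodic_embedding G \<phi>"
  shows "\<exists>c>0. \<forall>v\<in>pverts G. \<forall>n F. finite F \<longrightarrow> (neighbour_or_eq G ^^ n) `` {v} \<subseteq> F \<longrightarrow>
      c * real (Suc n) ^ CARD('d) \<le> real (card F)"
    and "\<exists>D. \<forall>v\<in>pverts G. out_degree (with_proj G) v \<le> D"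
proof -
  interpret pair_wf_digraph G by (rule G)
  let ?V = "pverts G" and ?N = "neighbour_or_eq G"
  define E where "E = map_prod \<phi> \<phi> ` parcs G"
  define S where "S = E \<union> E\<inverse> \<union> Id"
  have inj: "inj_on \<phi> ?V" using emb by (simp add: periodic_embedding_def)
  have "\<exists>L. full_rank_lattice L \<and>
      (\<forall>l\<in>L. (+) l ` (\<phi> ` ?V) = \<phi> ` ?V \<and> map_prod ((+) l) ((+) l) ` E = E) \<and>
      finite {{l + x | l. l \<in> L} | x. x \<in> \<phi> ` ?V}"
    using emb unfolding periodic_embedding_def E_def by (rule conjunct2)
  then obtain L where L_all: "full_rank_lattice L \<and>
      (\<forall>l\<in>L. (+) l ` (\<phi> ` ?V) = \<phi> ` ?V \<and> map_prod ((+) l) ((+) l) ` E = E) \<and>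
      finite {{l + x | l. l \<in> L} | x. x \<in> \<phi> ` ?V}" ..
  note L = L_all[THEN conjunct1] and aut = L_all[THEN conjunct2, THEN conjunct1]
    and fin = L_all[THEN conjunct2, THEN conjunct2]
  obtain B where B: "finite B" "card B = CARD('d)" "independent B" "B \<subseteq> L"
    and L': "\<forall>x\<in>L. \<forall>y\<in>L. x + y \<in> L" "\<forall>x\<in>L. - x \<in> L" "0 \<in> L"
    by (rule full_rank_lattice_basis[OF L]) (rule that)
  have E_translate: "(l + p, l + q) \<in> E" if "l \<in> L" "(p, q) \<in> E" for l p q
  proof -
    have "map_prod ((+) l) ((+) l) (p, q) \<in> E" using aut that by blast
    then show ?thesis by simp
  qed
  interpret lattice_invariant S L "\<phi> ` ?V"
  proof
    show "l + p \<in> \<phi> ` ?V" if "l \<in> L" "p \<in> \<phi> ` ?V" for l p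
      using aut that by blast
    show "(l + p, l + q) \<in> S" if "l \<in> L" "(p, q) \<in> S" for l p q
      using that E_translate unfolding S_def by blast
  qed (use L' fin in blast)+
  have N_S: "(\<phi> v, \<phi> w) \<in> S" if "(v, w) \<in> ?N" for v w
    using that by (force simp: neighbour_or_eq_def S_def E_def)
  \<comment> \<open>Conversely, a step between points comes from a step between vertices, by
    injectivity of \<open>\<phi>\<close> and because arcs end in vertices.\<close>
  have S_N: "\<exists>w\<in>?V. q = \<phi> w \<and> (v, w) \<in> ?N" if "(\<phi> v, q) \<in> S" "v \<in> ?V" for v q
    using that inj
    by (auto simp: neighbour_or_eq_def S_def E_def dest: inj_onD wellformed')
  have N_S_pow: "(\<phi> v, \<phi> w) \<in> S ^^ n" if "(v, w) \<in> ?N ^^ n" for v w n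
    using that by (induction n arbitrary: w) (auto dest: N_S)
  have S_N_pow: "\<exists>w\<in>?V. q = \<phi> w \<and> (v, w) \<in> ?N ^^ n" if "(\<phi> v, q) \<in> S ^^ n" "v \<in> ?V" for v q n
    using that
  proof (induction n arbitrary: q)
    case (Suc n)
    then obtain r where r: "(\<phi> v, r) \<in> S ^^ n" "(r, q) \<in> S" by auto
    with Suc obtain w where "w \<in> ?V" "r = \<phi> w" "(v, w) \<in> ?N ^^ n" by blast
    with r(2) S_N[of w q] show ?case by auto
  qed auto
  have "B \<noteq> {}" using B(2) by auto
  have S_refl: "Id \<subseteq> S" by (simp add: S_def)
  have S_conn: "\<exists>n. (p, q) \<in> S ^^ n" if "p \<in> \<phi> ` ?V" "q \<in> \<phi> ` ?V" for p q
    using connected_imp_neighbour_relpow[OF conn] N_S_pow that by blast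
  obtain c where c: "c > 0" "\<forall>p\<in>\<phi> ` ?V. \<forall>n F. finite F \<longrightarrow> (S ^^ n) `` {p} \<subseteq> F \<longrightarrow>
      c * real (Suc n) ^ card B \<le> real (card F)"
    using ball_growth[OF S_refl S_conn B(1,4,3) \<open>B \<noteq> {}\<close>] by blast
  show "\<exists>c>0. \<forall>v\<in>?V. \<forall>n F. finite F \<longrightarrow> (?N ^^ n) `` {v} \<subseteq> F \<longrightarrow>
      c * real (Suc n) ^ CARD('d) \<le> real (card F)"
  proof (intro exI[of _ c] conjI ballI allI impI)
    fix v n and F :: "'a set"
    assume v: "v \<in> ?V" and F: "finite F" "(?N ^^ n) `` {v} \<subseteq> F"
    have "(S ^^ n) `` {\<phi> v} \<subseteq> \<phi> ` F" using S_N_pow[OF _ v] F(2) by blast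
    then have "c * real (Suc n) ^ card B \<le> real (card (\<phi> ` F))"
      using v F by (intro c(2)[rule_format]) auto
    also have "\<dots> \<le> real (card F)" using F(1) by (simp add: card_image_le)
    finally show "c * real (Suc n) ^ CARD('d) \<le> real (card F)" by (simp add: B(2))
  qed (rule c(1))
  have "\<exists>D. \<forall>p\<in>\<phi> ` ?V. card (E `` {p}) \<le> D"
  proof (rule bounded_if_invariant)
    fix l p assume "l \<in> L" "p \<in> \<phi> ` ?V"
    have "E `` {l + p} = (+) l ` (E `` {p})"
    proof (intro set_eqI iffI)
      fix q assume "q \<in> E `` {l + p}"
      then have "- l + q \<in> E `` {p}"
        using E_translate[of "- l" "l + p" q] L'(2) \<open>l \<in> L\<close> by simp
      then show "q \<in> (+) l ` (E `` {p})" by (rule rev_image_eqI) simp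
    qed (use E_translate \<open>l \<in> L\<close> in auto)
    then show "card (E `` {l + p}) = card (E `` {p})"
      by (simp add: card_image)
  qed
  \<comment> \<open>Arcs are pairs, so an arc leaving \<open>v\<close> is determined by its
    target.\<close>
  moreover have "out_degree (with_proj G) v = card (E `` {\<phi> v})" if v: "v \<in> ?V" for v
  proof -
    have "bij_betw (\<lambda>e. \<phi> (snd e)) (out_arcs (with_proj G) v) (E `` {\<phi> v})"
    proof (rule bij_betw_imageI)
      show "inj_on (\<lambda>e. \<phi> (snd e)) (out_arcs (with_proj G) v)"
        using inj arc_snd_in_verts by (auto simp: inj_on_def out_arcs_def prod_eq_iff)
      show "(\<lambda>e. \<phi> (snd e)) ` out_arcs (with_proj G) v = E `` {\<phi> v}"
        using inj v by (force simp: out_arcs_def E_def dest: inj_onD wellformed')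
    qed
    then show ?thesis unfolding out_degree_def by (rule bij_betw_same_card)
  qed
  ultimately show "\<exists>D. \<forall>v\<in>?V. out_degree (with_proj G) v \<le> D" by auto
qed

section \<open>The range\<close>

text \<open>Raising the time bound to the power \<open>d\<close> and inserting the growth bound
  eliminates \<open>s\<close> and gives \<open>c * t ^ d \<le> D ^ d * k ^ Suc d\<close>; then the
  root of order \<open>d + 1\<close> is taken.\<close>

lemma powr_bound_of_growth:
  fixes c D k s t :: real
  assumes "c > 0" "D > 0" "k > 0" "t > 0" "s \<ge> 0" and growth: "c * s ^ d \<le> k" and t: "t \<le> s * (D * k)"
  shows "(c / D ^ d) powr (1 / (real d + 1)) * t powr (real d / (real d + 1)) \<le> k"
proof -
  have "c * t ^ d \<le> c * (s * (D * k)) ^ d"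
    using assms by (intro mult_left_mono power_mono) auto
  also have "\<dots> = (c * s ^ d) * (D * k) ^ d" by (simp add: power_mult_distrib)
  also have "\<dots> \<le> k * (D * k) ^ d"
    using assms by (intro mult_right_mono) auto
  also have "\<dots> = D ^ d * k ^ Suc d" by (simp add: power_mult_distrib)
  finally have le: "c / D ^ d * t ^ d \<le> k ^ Suc d"
    using assms(2) by (simp add: divide_le_eq mult.commute mult.left_commute)
  have "t powr (real d / (real d + 1)) = (t ^ d) powr (1 / (real d + 1))"
    using assms(4) by (simp add: powr_powr flip: powr_realpow)
  then have "(c / D ^ d) powr (1 / (real d + 1)) * t powr (real d / (real d + 1))
      = (c / D ^ d * t ^ d) powr (1 / (real d + 1))"
    using assms by (simp only: powr_mult)
  also have "\<dots> \<le> (k ^ Suc d) powr (1 / (real d + 1))"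
    using le assms by (intro powr_mono2) auto
  also have "\<dots> = (k powr real (Suc d)) powr (1 / (real d + 1))"
    using assms(3) by (simp only: powr_realpow)
  also have "\<dots> = k powr 1"
    by (simp add: powr_powr add.commute)
  also have "\<dots> = k" using assms(3) by simp
  finally show ?thesis .
qed

theorem theorem1p1:
  fixes G :: "'a pair_pre_digraph"
  assumes "pair_wf_digraph G"
    and "\<forall>v\<in>pverts G. finite (out_arcs (with_proj G) v) \<and> out_arcs (with_proj G) v \<noteq> {}"
    and "Digraph_Component.connected (with_proj G)"
    and "eulerian_digraph G"
    and "\<exists>\<phi> :: 'a \<Rightarrow> real ^ 'd. periodic_embedding G \<phi>"
  shows "\<exists>c::real. c > 0 \<and>
    (\<forall>m \<rho> x0 t. rotor_mechanism G m \<longrightarrow> rotor_configuration G \<rho> \<longrightarrow> x0 \<in> pverts G \<longrightarrow> t \<ge> 1 \<longrightarrow>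
       real (card (rotor_range m \<rho> x0 t)) \<ge> c * real t powr (real CARD('d) / (real CARD('d) + 1)))"
proof -
  obtain \<phi> :: "'a \<Rightarrow> real ^ 'd" where emb: "periodic_embedding G \<phi>" using assms(5) ..
  let ?d = "CARD('d)"
  obtain c where c: "c > 0" and growth: "\<forall>v\<in>pverts G. \<forall>n F. finite F \<longrightarrow>
      (neighbour_or_eq G ^^ n) `` {v} \<subseteq> F \<longrightarrow> c * real (Suc n) ^ ?d \<le> real (card F)"
    using periodic_growth_and_degree(1)[OF assms(1,3) emb] by blast
  obtain D where D: "\<forall>v\<in>pverts G. out_degree (with_proj G) v \<le> D"
    using periodic_growth_and_degree(2)[OF assms(1,3) emb] ..
  \<comment> \<open>The constant of \<open>powr_bound_of_growth\<close>, with \<open>Suc D\<close>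
    in place of \<open>D\<close> to ensure positivity.\<close>
  define C where "C = (c / real (Suc D) ^ ?d) powr (1 / (real ?d + 1))"
  have "C > 0" using c by (simp add: C_def)
  \<comment> \<open>The range omits time 0, whereas \<open>C\<close> bounds the set of vertices from
    time 0 on. Adding \<open>x0\<close> to the nonempty range at most doubles its cardinality, hence
    the factor one half.\<close>
  have "C / 2 * real t powr (real ?d / (real ?d + 1)) \<le> real (card (rotor_range m \<rho> x0 t))"
    if m: "rotor_mechanism G m" and \<rho>: "rotor_configuration G \<rho>" and x0: "x0 \<in> pverts G"
      and t: "t \<ge> 1" for m \<rho> x0 t
  proof -
    interpret pair_wf_digraph G by (rule assms(1))
    interpret rotor_walk_run G m \<rho> x0
      by unfold_locales (use assms(2,4) m \<rho> x0 in auto)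
    let ?Y = "X ` {..t}"
    have "out_degree (with_proj G) v \<le> Suc D" if "v \<in> pverts G" for v
      using D that le_SucI by blast
    then obtain n where n: "(neighbour_or_eq G ^^ n) `` {x0} \<subseteq> ?Y"
      "t \<le> Suc n * (Suc D * card ?Y)"
      using ball_subset_range[of "Suc D" t] by blast
    have "real t \<le> real (Suc n * (Suc D * card ?Y))" using n(2) by (rule of_nat_mono)
    then have "real t \<le> real (Suc n) * (real (Suc D) * real (card ?Y))" by (simp only: of_nat_mult)
    moreover have "c * real (Suc n) ^ ?d \<le> real (card ?Y)"
      using growth x0 n(1) by blast
    moreover have "card ?Y > 0" by (simp add: card_gt_0_iff)
    ultimately have "C * real t powr (real ?d / (real ?d + 1)) \<le> real (card ?Y)"
      unfolding C_def using c t by (intro powr_bound_of_growth[where s = "real (Suc n)"]) auto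
    also have "card ?Y \<le> 2 * card (rotor_range m \<rho> x0 t)"
    proof -
      have "{..t} = insert 0 {1..t}" by auto
      then have "?Y = insert x0 (rotor_range m \<rho> x0 t)"
        by (simp add: rotor_range_def)
      then have "card ?Y \<le> Suc (card (rotor_range m \<rho> x0 t))"
        by (simp add: card_insert_le_m1 rotor_range_def card_insert_if)
      moreover have "card (rotor_range m \<rho> x0 t) > 0"
        using t by (simp add: rotor_range_def card_gt_0_iff)
      ultimately show ?thesis by simp
    qed
    then have "real (card ?Y) \<le> 2 * real (card (rotor_range m \<rho> x0 t))" by linarith
    finally show ?thesis by simp
  qed
  then show ?thesis using \<open>C > 0\<close> by (intro exI[of _ "C / 2"]) auto
qed

end
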